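(* For any $r \in (0,1)$ and $\varepsilon > 0$, there exist independent random vectors $X_1, \dots, X_n$ in $\mathbb{R}^d$, for some $d \geq 1$ and $n \geq 2$, such that $$N_r(X_1 + \cdots + X_n) < \varepsilon \sum_{i=1}^n N_r(X_i).$$
   Context: For a random vector $X$ in $\mathbb{R}^d$ with density $f$ with respect to Lebesgue measure and $r \in (0,1)\cup(1,\infty)$, the $r$-R\'enyi entropy is $h_r(X) = \frac{1}{1-r}\log \int_{\mathbb{R}^d} f(x)^r\,dx$, and the $r$-R\'enyi entropy power is $N_r(X) = e^{2h_r(X)/d}$. *)

theory Defs
  imports "HOL-Probability.Probability"
begin

text \<open>
  The dimension \<open>d\<close> is existentially quantified, so \<open>\<real>\<^sup>d\<close> is not represented by a type but by the
  functions \<open>nat \<Rightarrow> real\<close> that are \<open>undefined\<close> outside \<open>{..<d}\<close>, with the product of \<open>d\<close> copies of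
  Lebesgue measure.
\<close>

definition lborel_vec :: "nat \<Rightarrow> (nat \<Rightarrow> real) measure" where
  "lborel_vec d = (\<Pi>\<^sub>M k\<in>{..<d}. lborel)"

definition vec_sum :: "nat \<Rightarrow> ('i \<Rightarrow> 'w \<Rightarrow> nat \<Rightarrow> real) \<Rightarrow> 'i set \<Rightarrow> 'w \<Rightarrow> nat \<Rightarrow> real" where
  "vec_sum d X I \<omega> = (\<lambda>k\<in>{..<d}. \<Sum>i\<in>I. X i \<omega> k)"

definition has_density :: "'w measure \<Rightarrow> nat \<Rightarrow> ('w \<Rightarrow> nat \<Rightarrow> real) \<Rightarrow> bool" where
  "has_density M d X \<longleftrightarrow> (\<exists>f. distributed M (lborel_vec d) X f)"

text \<open>
  The integral of \<open>f\<^sup>r\<close> may be infinite. Entropies and entropy powers are therefore extended-valued,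
  with \<open>log 0 = -\<infinity>\<close>, \<open>log \<infinity> = \<infinity>\<close>, \<open>e\<^sup>-\<^sup>\<infinity> = 0\<close> and \<open>e\<^sup>\<infinity> = \<infinity>\<close>.
\<close>

definition ext_ln :: "ennreal \<Rightarrow> ereal" where
  "ext_ln x = (if x = 0 then -\<infinity> else if x = \<infinity> then \<infinity> else ereal (ln (enn2real x)))"

definition ext_exp :: "ereal \<Rightarrow> ennreal" where
  "ext_exp x = (if x = -\<infinity> then 0 else if x = \<infinity> then \<infinity> else ennreal (exp (real_of_ereal x)))"

text \<open>
  The density of \<open>X\<close> is the Radon-Nikodym derivative of its law. It is almost everywhere
  finite, and \<open>enn2real\<close> only changes it on a null set. If \<open>X\<close> has no density, the values
  below are meaningless.
\<close>

definition renyi_entropy :: "'w measure \<Rightarrow> nat \<Rightarrow> real \<Rightarrow> ('w \<Rightarrow> nat \<Rightarrow> real) \<Rightarrow> ereal" where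
  "renyi_entropy M d r X =
     ereal (1 / (1 - r)) *
     ext_ln (\<integral>\<^sup>+ x. ennreal (enn2real (RN_deriv (lborel_vec d) (distr M (lborel_vec d) X) x) powr r)
               \<partial>lborel_vec d)"

definition renyi_entropy_power :: "'w measure \<Rightarrow> nat \<Rightarrow> real \<Rightarrow> ('w \<Rightarrow> nat \<Rightarrow> real) \<Rightarrow> ennreal" where
  "renyi_entropy_power M d r X = ext_exp (ereal (2 / real d) * renyi_entropy M d r X)"

lemma sigma_finite_lborel_vec: "sigma_finite_measure (lborel_vec d)"
proof -
  interpret finite_product_sigma_finite "\<lambda>_. lborel :: real measure" "{..<d}"
    by standard simp
  show ?thesis
    unfolding lborel_vec_def by (rule sigma_finite_measure_axioms)
qed

lemma renyi_entropy_distributed: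
  assumes "distributed M (lborel_vec d) X f"
  shows "renyi_entropy M d r X =
    ereal (1 / (1 - r)) * ext_ln (\<integral>\<^sup>+ x. ennreal (enn2real (f x) powr r) \<partial>lborel_vec d)"
proof -
  interpret sigma_finite_measure "lborel_vec d"
    by (rule sigma_finite_lborel_vec)
  have "AE x in lborel_vec d. f x = RN_deriv (lborel_vec d) (distr M (lborel_vec d) X) x"
    using assms by (intro RN_deriv_unique) (auto simp: distributed_def)
  then have "(\<integral>\<^sup>+ x. ennreal (enn2real (RN_deriv (lborel_vec d) (distr M (lborel_vec d) X) x) powr r)
      \<partial>lborel_vec d) = (\<integral>\<^sup>+ x. ennreal (enn2real (f x) powr r) \<partial>lborel_vec d)"
    by (intro nn_integral_cong_AE) auto
  then show ?thesis
    by (simp add: renyi_entropy_def)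
qed

end

theory Submission
  imports Defs
begin

text \<open>
  For \<open>r < 1\<close> the integral of \<open>f\<^sup>r\<close> sees spread much more than mass: a component of tiny mass \<open>p\<close>
  spread evenly over a cube of huge side \<open>L\<close> contributes \<open>p\<^sup>r L\<^sup>s\<close>, where \<open>s = d (1 - r)\<close>, and this can be
  large. So let \<open>X\<^sub>1, \<dots>, X\<^sub>n\<close> be independent copies of a vector that is uniform on the unit cube with
  probability \<open>1 - p\<close> and uniform on the cube of side \<open>L\<close> with probability \<open>p\<close>. The entropy integral
  of each is at least \<open>p\<^sup>r L\<^sup>s\<close> (\<open>two_scale_entropy_integral_ge\<close>).

  The sum is spread out mainly when exactly one summand is large. This has probability about \<open>n p\<close>
  and fills a cube of side about \<open>L\<close>, so it contributes about \<open>n\<^sup>r p\<^sup>r L\<^sup>s\<close>: merging the \<open>n\<close> large parts in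
  one place multiplies the entropy integral by only \<open>n\<^sup>r\<close>. If no summand is large the sum lives in a
  bounded cube, and two large summands have probability of order \<open>p\<^sup>2\<close>; for a suitable relation
  between \<open>p\<close> and \<open>L\<close> both cases become negligible as \<open>L\<close> grows (\<open>two_scale_parameters\<close>). The
  mass-volume inequality \<open>nn_integral_powr_le\<close> turns these probabilities into bounds on the entropy
  integral, with no computation of the density of the sum; that it exists is
  \<open>has_density_vec_sum\<close>.

  The entropy power is the power of exponent \<open>2 / s\<close> of the entropy integral. Hence the entropy power
  of the sum is at most \<open>(2 n\<^sup>r)\<^bsup>2 / s\<^esup> \<le> (2 n)\<^bsup>2 / s\<^esup>\<close> times \<open>(p\<^sup>r L\<^sup>s)\<^bsup>2 / s\<^esup>\<close>, while the sum of the entropy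
  powers is at least \<open>n\<close> times that same quantity. Taking \<open>d\<close> so large that \<open>s \<ge> 4\<close>, the first
  factor is at most \<open>sqrt (2 n)\<close>, which is below \<open>\<epsilon> n\<close> for large \<open>n\<close>.
\<close>

section \<open>Cubes and translations in \<open>\<real>\<^sup>d\<close>\<close>

definition cube :: "nat \<Rightarrow> real \<Rightarrow> (nat \<Rightarrow> real) set" where
  "cube d a = (\<Pi>\<^sub>E k\<in>{..<d}. {0..a})"

lemma space_lborel_vec: "space (lborel_vec d) = ({..<d} \<rightarrow>\<^sub>E UNIV)"
  by (simp add: lborel_vec_def space_PiM)

lemma sets_cube [measurable]: "cube d a \<in> sets (lborel_vec d)"
  unfolding cube_def lborel_vec_def by (intro sets_PiM_I_finite) auto

lemma emeasure_lborel_vec_PiE: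
  assumes "\<And>k. k < d \<Longrightarrow> A k \<in> sets borel"
  shows "emeasure (lborel_vec d) (Pi\<^sub>E {..<d} A) = (\<Prod>k<d. emeasure lborel (A k))"
proof -
  interpret product_sigma_finite "\<lambda>_. lborel :: real measure"
    by standard
  show ?thesis
    unfolding lborel_vec_def using assms by (subst emeasure_PiM) auto
qed

lemma emeasure_cube: "0 \<le> a \<Longrightarrow> emeasure (lborel_vec d) (cube d a) = ennreal (a ^ d)"
  unfolding cube_def by (subst emeasure_lborel_vec_PiE) (auto simp: prod_ennreal ennreal_power)

lemma cube_mono: "a \<le> b \<Longrightarrow> cube d a \<subseteq> cube d b"
  unfolding cube_def by (intro PiE_mono) auto

lemma sum_mem_cube:
  assumes "\<And>i. i \<in> I \<Longrightarrow> X i \<omega> \<in> cube d (a i)"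
  shows "vec_sum d X I \<omega> \<in> cube d (sum a I)"
proof -
  have "0 \<le> X i \<omega> k \<and> X i \<omega> k \<le> a i" if "i \<in> I" "k < d" for i k
    using assms[OF that(1)] that(2) by (auto simp: cube_def PiE_iff)
  then show ?thesis
    by (auto simp: cube_def vec_sum_def intro!: sum_nonneg sum_mono)
qed

lemma measurable_component_lborel_vec:
  "k < d \<Longrightarrow> (\<lambda>x. x k) \<in> borel_measurable (lborel_vec d)"
  unfolding lborel_vec_def
  using measurable_component_singleton[of k "{..<d}" "\<lambda>_. lborel :: real measure"] by simp

lemma measurable_into_lborel_vec:
  assumes "\<And>k. k < d \<Longrightarrow> (\<lambda>\<omega>. X \<omega> k) \<in> borel_measurable M"
  shows "(\<lambda>\<omega>. \<lambda>k\<in>{..<d}. X \<omega> k) \<in> measurable M (lborel_vec d)"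
  unfolding lborel_vec_def using assms by (intro measurable_restrict) auto

lemma measurable_vec_sum:
  assumes "\<And>i. i \<in> I \<Longrightarrow> X i \<in> measurable M (lborel_vec d)"
  shows "vec_sum d X I \<in> measurable M (lborel_vec d)"
  unfolding vec_sum_def
  by (intro measurable_into_lborel_vec borel_measurable_sum
      measurable_compose[OF assms measurable_component_lborel_vec])

text \<open>
  Absolute continuity of a sum needs only this: translating a null set leaves it null.
\<close>

lemma lborel_vec_translation_invariant:
  "distr (lborel_vec d) (lborel_vec d) (\<lambda>x. \<lambda>k\<in>{..<d}. x k + c k) = lborel_vec d"
    (is "distr _ _ ?T = _")
proof -
  interpret product_sigma_finite "\<lambda>_. lborel :: real measure"
    by standard
  have T: "?T \<in> measurable (lborel_vec d) (lborel_vec d)"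
    by (intro measurable_into_lborel_vec borel_measurable_add measurable_component_lborel_vec) auto
  have "distr (lborel_vec d) (lborel_vec d) ?T = PiM {..<d} (\<lambda>_. lborel)"
  proof (rule PiM_eqI)
    fix A :: "nat \<Rightarrow> real set"
    assume A: "\<And>k. k \<in> {..<d} \<Longrightarrow> A k \<in> sets lborel"
    let ?B = "\<lambda>k. (+) (c k) -` A k"
    have B: "?B k \<in> sets borel" if "k < d" for k
      using A[of k] that measurable_sets[of "(+) (c k)" borel borel "A k"] by simp
    have "emeasure lborel (?B k) = emeasure lborel (A k)" if "k < d" for k
      using A[of k] that
      by (subst (2) lborel_distr_plus[of "c k", symmetric], subst emeasure_distr) auto
    moreover have "?T -` Pi\<^sub>E {..<d} A \<inter> space (lborel_vec d) = Pi\<^sub>E {..<d} ?B"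
      by (auto simp: space_lborel_vec PiE_iff add.commute)
    moreover have "Pi\<^sub>E {..<d} A \<in> sets (lborel_vec d)"
      unfolding lborel_vec_def using A by (intro sets_PiM_I_finite) auto
    ultimately show "emeasure (distr (lborel_vec d) (lborel_vec d) ?T) (Pi\<^sub>E {..<d} A)
        = (\<Prod>k\<in>{..<d}. emeasure lborel (A k))"
      using B by (simp add: emeasure_distr[OF T] emeasure_lborel_vec_PiE)
  qed (simp_all add: lborel_vec_def)
  then show ?thesis
    by (simp add: lborel_vec_def)
qed

section \<open>Sums that inherit a density\<close>

context prob_space
begin

lemma has_density_iff_absolutely_continuous:
  assumes X: "X \<in> measurable M (lborel_vec d)"
  shows "has_density M d X \<longleftrightarrow> absolutely_continuous (lborel_vec d) (distr M (lborel_vec d) X)"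
proof
  assume "has_density M d X"
  then obtain f where f: "distributed M (lborel_vec d) X f"
    by (auto simp: has_density_def)
  then show "absolutely_continuous (lborel_vec d) (distr M (lborel_vec d) X)"
    by (auto simp: distributed_def intro!: absolutely_continuousI_density)
next
  interpret L: sigma_finite_measure "lborel_vec d"
    by (rule sigma_finite_lborel_vec)
  assume "absolutely_continuous (lborel_vec d) (distr M (lborel_vec d) X)"
  then obtain f where "f \<in> borel_measurable (lborel_vec d)"
      "density (lborel_vec d) f = distr M (lborel_vec d) X"
    using L.Radon_Nikodym[of "distr M (lborel_vec d) X"] by auto
  then show "has_density M d X"
    using X unfolding has_density_def distributed_def by (intro exI[of _ f]) auto
qed

text \<open>
  One summand with a density is enough: conditionally on \<open>Y = y\<close>, the sum falls in a null set
  \<open>N\<close> exactly when \<open>X\<close> falls in the translate of \<open>N\<close> by \<open>-y\<close>, which is null as well. Integrating over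
  the law of \<open>Y\<close> shows that the sum has an absolutely continuous law.
\<close>

lemma has_density_add:
  assumes indep: "indep_var (lborel_vec d) X (lborel_vec d) Y"
    and dens: "has_density M d X"
  shows "has_density M d (\<lambda>\<omega>. \<lambda>k\<in>{..<d}. X \<omega> k + Y \<omega> k)" (is "has_density M d ?S")
proof -
  let ?L = "lborel_vec d"
  let ?add = "\<lambda>(x, y). \<lambda>k\<in>{..<d}. x k + y k :: real"
  have [measurable]: "X \<in> measurable M ?L" "Y \<in> measurable M ?L"
    and pair: "distr M ?L X \<Otimes>\<^sub>M distr M ?L Y = distr M (?L \<Otimes>\<^sub>M ?L) (\<lambda>\<omega>. (X \<omega>, Y \<omega>))"
    using indep unfolding indep_var_distribution_eq by auto
  have add [measurable]: "?add \<in> measurable (?L \<Otimes>\<^sub>M ?L) ?L"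
    unfolding case_prod_beta
    by (intro measurable_into_lborel_vec borel_measurable_add
        measurable_compose[OF measurable_fst measurable_component_lborel_vec]
        measurable_compose[OF measurable_snd measurable_component_lborel_vec])
  have S_eq: "?S = (\<lambda>\<omega>. ?add (X \<omega>, Y \<omega>))"
    by simp
  have S [measurable]: "?S \<in> measurable M ?L"
    unfolding S_eq by measurable
  interpret X: prob_space "distr M ?L X"
    by (rule prob_space_distr) simp
  interpret Y: prob_space "distr M ?L Y"
    by (rule prob_space_distr) simp
  interpret XY: pair_sigma_finite "distr M ?L X" "distr M ?L Y" ..
  have ac: "absolutely_continuous ?L (distr M ?L X)"
    using dens by (subst has_density_iff_absolutely_continuous[symmetric]) auto
  have "absolutely_continuous ?L (distr M ?L ?S)"
    unfolding absolutely_continuous_def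
  proof
    fix N assume N: "N \<in> null_sets ?L"
    then have [measurable]: "N \<in> sets ?L" by auto
    let ?A = "?add -` N \<inter> space (?L \<Otimes>\<^sub>M ?L)"
    have A: "?A \<in> sets (distr M ?L X \<Otimes>\<^sub>M distr M ?L Y)"
      using measurable_sets[OF add, of N] by simp
    have slice: "emeasure (distr M ?L X) ((\<lambda>x. (x, y)) -` ?A) = 0" if y: "y \<in> space ?L" for y
    proof -
      let ?T = "\<lambda>x. \<lambda>k\<in>{..<d}. x k + y k"
      have T: "?T \<in> measurable ?L ?L"
        by (intro measurable_into_lborel_vec borel_measurable_add measurable_component_lborel_vec) auto
      have "(\<lambda>x. (x, y)) -` ?A = ?T -` N \<inter> space ?L"
        using y by (auto simp: space_pair_measure)
      moreover have "emeasure ?L (?T -` N \<inter> space ?L) = 0"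
        using N lborel_vec_translation_invariant[of d y]
        by (subst emeasure_distr[OF T, symmetric]) auto
      ultimately have "(\<lambda>x. (x, y)) -` ?A \<in> null_sets ?L"
        using measurable_sets[OF T, of N] by auto
      then show ?thesis
        using ac by (auto simp: absolutely_continuous_def)
    qed
    have "emeasure (distr M ?L ?S) N = emeasure M ((\<lambda>\<omega>. (X \<omega>, Y \<omega>)) -` ?A \<inter> space M)"
      by (subst emeasure_distr)
        (auto intro!: arg_cong[where f = "emeasure M"] simp: space_pair_measure
          measurable_space[of X M ?L] measurable_space[of Y M ?L])
    also have "\<dots> = emeasure (distr M (?L \<Otimes>\<^sub>M ?L) (\<lambda>\<omega>. (X \<omega>, Y \<omega>))) ?A"
      by (subst emeasure_distr) auto
    also have "\<dots> = (\<integral>\<^sup>+y. emeasure (distr M ?L X) ((\<lambda>x. (x, y)) -` ?A) \<partial>distr M ?L Y)"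
      unfolding pair[symmetric] by (rule XY.emeasure_pair_measure_alt2[OF A])
    also have "\<dots> = (\<integral>\<^sup>+y. 0 \<partial>distr M ?L Y)"
      by (intro nn_integral_cong slice) simp
    finally show "N \<in> null_sets (distr M ?L ?S)"
      by auto
  qed
  then show ?thesis
    using has_density_iff_absolutely_continuous[OF S] by simp
qed

text \<open>
  Split off the summand that has a density; it is independent of the sum of all the others.
\<close>

lemma has_density_vec_sum:
  assumes indep: "indep_vars (\<lambda>_. lborel_vec d) X I" and I: "finite I"
    and j: "j \<in> I" "has_density M d (X j)"
  shows "has_density M d (vec_sum d X I)"
proof -
  let ?R = "\<lambda>x. vec_sum d (\<lambda>i x. x i) (I - {j}) x"
  have "indep_var (PiM {j} (\<lambda>_. lborel_vec d)) (\<lambda>\<omega>. \<lambda>i\<in>{j}. X i \<omega>)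
      (PiM (I - {j}) (\<lambda>_. lborel_vec d)) (\<lambda>\<omega>. \<lambda>i\<in>I - {j}. X i \<omega>)"
    using j by (intro indep_var_restrict[OF indep]) auto
  then have "indep_var (lborel_vec d) ((\<lambda>x. x j) \<circ> (\<lambda>\<omega>. \<lambda>i\<in>{j}. X i \<omega>))
      (lborel_vec d) (?R \<circ> (\<lambda>\<omega>. \<lambda>i\<in>I - {j}. X i \<omega>))"
    by (rule indep_var_compose)
      (auto intro!: measurable_vec_sum measurable_component_singleton)
  moreover have "(\<lambda>x. x j) \<circ> (\<lambda>\<omega>. \<lambda>i\<in>{j}. X i \<omega>) = X j"
    by auto
  moreover have "?R \<circ> (\<lambda>\<omega>. \<lambda>i\<in>I - {j}. X i \<omega>) = vec_sum d X (I - {j})"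
    by (auto simp: vec_sum_def fun_eq_iff)
  ultimately have "has_density M d (\<lambda>\<omega>. \<lambda>k\<in>{..<d}. X j \<omega> k + vec_sum d X (I - {j}) \<omega> k)"
    using j(2) by (intro has_density_add) simp_all
  also have "(\<lambda>\<omega>. \<lambda>k\<in>{..<d}. X j \<omega> k + vec_sum d X (I - {j}) \<omega> k) = vec_sum d X I"
    using I j(1) by (auto simp: vec_sum_def fun_eq_iff sum.remove[of I j])
  finally show ?thesis .
qed

end

lemma indep_vars_PiM_coordinates:
  assumes "\<And>i. i \<in> I \<Longrightarrow> prob_space (N i)" "I \<noteq> {}"
  shows "prob_space.indep_vars (PiM I N) N (\<lambda>i x. x i) I"
proof -
  interpret prob_space "PiM I N"
    using assms(1) by (rule prob_space_PiM)
  have "distr (PiM I N) (PiM I N) (\<lambda>x. \<lambda>i\<in>I. x i) = distr (PiM I N) (PiM I N) (\<lambda>x. x)"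
    by (intro distr_cong) (auto simp: space_PiM)
  also have "\<dots> = PiM I N"
    by (rule distr_id)
  also have "\<dots> = PiM I (\<lambda>i. distr (PiM I N) (N i) (\<lambda>x. x i))"
    by (intro PiM_cong refl) (rule distr_PiM_component[OF assms(1), symmetric])
  finally show ?thesis
    using assms(2) by (subst indep_vars_iff_distr_eq_PiM') auto
qed

section \<open>Upper bounds on the entropy integral\<close>

text \<open>
  The right-hand side is the tangent at \<open>c\<close> of the concave function \<open>y \<mapsto> y\<^sup>r\<close>.
\<close>

lemma powr_le_tangent:
  fixes r :: real
  assumes r: "0 < r" "r < 1" and y: "0 \<le> y" and c: "0 < c"
  shows "y powr r \<le> r * c powr (r - 1) * y + (1 - r) * c powr r"
proof (cases "y = 0")
  case True
  then show ?thesis using r by simp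
next
  case False
  then have "y powr r * c powr (1 - r) \<le> r * y + (1 - r) * c"
    using r y c by (intro Youngs_inequality_0) auto
  then have "(y powr r * c powr (1 - r)) * c powr (r - 1) \<le> (r * y + (1 - r) * c) * c powr (r - 1)"
    by (intro mult_right_mono) auto
  also have "(y powr r * c powr (1 - r)) * c powr (r - 1) = y powr r"
    using c by (simp add: mult.assoc powr_add[symmetric])
  also have "(r * y + (1 - r) * c) * c powr (r - 1) = r * c powr (r - 1) * y + (1 - r) * c powr r"
    using c powr_add[of c 1 "r - 1"] by (simp add: algebra_simps)
  finally show ?thesis .
qed

text \<open>
  Among densities of mass \<open>m\<close> on a region of volume \<open>V\<close>, the constant one maximizes the integral of
  the \<open>r\<close>-th power, because \<open>r < 1\<close>. This is Jensen's inequality; integrating the tangent at the mean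
  density proves it even when only upper bounds on mass and volume are known.
\<close>

lemma nn_integral_powr_le:
  fixes r :: real
  assumes r: "0 < r" "r < 1"
    and f [measurable]: "f \<in> borel_measurable N" and K [measurable]: "K \<in> sets N"
    and vol: "emeasure N K \<le> ennreal V" "0 < V"
    and mass: "(\<integral>\<^sup>+x. f x * indicator K x \<partial>N) \<le> ennreal m" "0 < m"
  shows "(\<integral>\<^sup>+x. ennreal (enn2real (f x) powr r) * indicator K x \<partial>N) \<le> ennreal (m powr r * V powr (1 - r))"
proof -
  \<comment> \<open>Tangency at the mean density makes the two terms of the integrated bound add up to the optimum.\<close>
  define c where "c = m / V"
  have c: "0 < c" using vol mass by (simp add: c_def)
  let ?\<alpha> = "ennreal (r * c powr (r - 1))" and ?\<beta> = "ennreal ((1 - r) * c powr r)"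
  have tangent: "ennreal (enn2real y powr r) \<le> ?\<alpha> * y + ?\<beta>" for y
  proof (cases y)
    case (real z)
    then show ?thesis
      using powr_le_tangent[OF r, of z c] c r
      by (simp add: ennreal_mult'[symmetric] ennreal_plus[symmetric] ennreal_leI del: ennreal_plus)
  qed simp
  have "(\<integral>\<^sup>+x. ennreal (enn2real (f x) powr r) * indicator K x \<partial>N)
      \<le> (\<integral>\<^sup>+x. ?\<alpha> * (f x * indicator K x) + ?\<beta> * indicator K x \<partial>N)"
    using tangent by (intro nn_integral_mono) (simp split: split_indicator)
  also have "\<dots> = ?\<alpha> * (\<integral>\<^sup>+x. f x * indicator K x \<partial>N) + ?\<beta> * emeasure N K"
    by (simp add: nn_integral_add nn_integral_cmult)
  also have "\<dots> \<le> ?\<alpha> * ennreal m + ?\<beta> * ennreal V"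
    using vol mass by (intro add_mono mult_left_mono) auto
  also have "\<dots> = ennreal (r * c powr (r - 1) * m + (1 - r) * c powr r * V)"
    using r vol mass by (simp add: ennreal_mult'[symmetric] ennreal_plus[symmetric] del: ennreal_plus)
  also have "r * c powr (r - 1) * m + (1 - r) * c powr r * V = m powr r * V powr (1 - r)"
  proof -
    have "c powr (r - 1) * m = m powr r * V powr (1 - r)"
      using vol mass by (simp add: c_def powr_divide powr_diff field_simps)
    moreover have "c powr r * V = m powr r * V powr (1 - r)"
      using vol mass by (simp add: c_def powr_divide powr_diff field_simps)
    ultimately show ?thesis
      by (simp add: algebra_simps)
  qed
  finally show ?thesis .
qed

lemma emeasure_cube_diff_le: "0 \<le> b \<Longrightarrow> emeasure (lborel_vec d) (cube d b - A) \<le> ennreal (b ^ d)"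
  using emeasure_mono[of "cube d b - A" "cube d b" "lborel_vec d"] by (simp add: emeasure_cube sets_cube)

context prob_space
begin

text \<open>
  A law whose tails are controlled at three scales: cut \<open>\<real>\<^sup>d\<close> into the cube of side \<open>a\<close>, the part of the
  cube of side \<open>b\<close> outside it, and the remaining part of the cube of side \<open>c\<close>, and apply the
  mass-volume bound on each. The mass of a later part is at most that of the tail beyond the cube
  before it.
\<close>

lemma entropy_integral_le_cubes:
  fixes r :: real
  assumes g: "distributed M (lborel_vec d) X g"
    and r: "0 < r" "r < 1" and pos: "0 < a" "0 < b" "0 < c" "0 < p" "0 < q"
    and a: "prob {\<omega> \<in> space M. X \<omega> \<notin> cube d a} \<le> p"
    and b: "prob {\<omega> \<in> space M. X \<omega> \<notin> cube d b} \<le> q"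
    and c: "AE \<omega> in M. X \<omega> \<in> cube d c"
  defines "s \<equiv> real d * (1 - r)"
  shows "(\<integral>\<^sup>+x. ennreal (enn2real (g x) powr r) \<partial>lborel_vec d)
    \<le> ennreal (a powr s + p powr r * b powr s + q powr r * c powr s)"
proof -
  let ?L = "lborel_vec d" and ?h = "\<lambda>x. ennreal (enn2real (g x) powr r)"
  let ?K = "cube d a" and ?K' = "cube d b - cube d a" and ?K'' = "cube d c - cube d b"
  have [measurable]: "g \<in> borel_measurable ?L" "X \<in> measurable M ?L"
    and distr: "distr M ?L X = density ?L g"
    using g by (auto simp: distributed_def)
  have mass: "(\<integral>\<^sup>+x. g x * indicator A x \<partial>?L) = prob {\<omega> \<in> space M. X \<omega> \<in> A}"
    if [measurable]: "A \<in> sets ?L" for A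
  proof -
    have "(\<integral>\<^sup>+x. g x * indicator A x \<partial>?L) = emeasure (distr M ?L X) A"
      by (simp add: distr emeasure_density)
    also have "\<dots> = prob {\<omega> \<in> space M. X \<omega> \<in> A}"
      by (simp add: emeasure_distr vimage_def Int_def conj_commute emeasure_eq_measure)
    finally show ?thesis .
  qed
  have piece: "(\<integral>\<^sup>+x. ?h x * indicator A x \<partial>?L) \<le> ennreal (m powr r * t powr s)"
    if A [measurable]: "A \<in> sets ?L" and m: "prob {\<omega> \<in> space M. X \<omega> \<in> A} \<le> m" "0 < m"
      and t: "emeasure ?L A \<le> ennreal (t ^ d)" "0 < t" for A m t
  proof -
    have "(\<integral>\<^sup>+x. ?h x * indicator A x \<partial>?L) \<le> ennreal (m powr r * (t ^ d) powr (1 - r))"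
      using m t by (intro nn_integral_powr_le r) (auto simp: mass ennreal_leI)
    also have "(t ^ d) powr (1 - r) = t powr s"
      using t by (simp add: s_def powr_powr flip: powr_realpow)
    finally show ?thesis .
  qed
  \<comment> \<open>The three parts cover the law, so the density vanishes almost everywhere off them.\<close>
  have "AE x in density ?L g. x \<in> cube d c"
    unfolding distr[symmetric] using c by (subst AE_distr_iff) auto
  then have "AE x in ?L. 0 < g x \<longrightarrow> x \<in> cube d c"
    by (subst (asm) AE_density) auto
  then have "AE x in ?L. ?h x \<le> ?h x * indicator ?K x + ?h x * indicator ?K' x + ?h x * indicator ?K'' x"
  proof eventually_elim
    case (elim x)
    then show ?case
      by (cases "g x = 0") (auto simp: zero_less_iff_neq_zero split: split_indicator)
  qed
  then have "(\<integral>\<^sup>+x. ?h x \<partial>?L)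
      \<le> (\<integral>\<^sup>+x. ?h x * indicator ?K x + ?h x * indicator ?K' x + ?h x * indicator ?K'' x \<partial>?L)"
    by (rule nn_integral_mono_AE)
  also have "\<dots> = (\<integral>\<^sup>+x. ?h x * indicator ?K x \<partial>?L) + (\<integral>\<^sup>+x. ?h x * indicator ?K' x \<partial>?L)
      + (\<integral>\<^sup>+x. ?h x * indicator ?K'' x \<partial>?L)"
    by (simp add: nn_integral_add)
  also have "\<dots> \<le> ennreal (1 powr r * a powr s) + ennreal (p powr r * b powr s) + ennreal (q powr r * c powr s)"
  proof (intro add_mono piece)
    have "prob {\<omega> \<in> space M. X \<omega> \<in> ?K'} \<le> prob {\<omega> \<in> space M. X \<omega> \<notin> cube d a}"
      by (intro finite_measure_mono) auto
    with a show "prob {\<omega> \<in> space M. X \<omega> \<in> ?K'} \<le> p" by simp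
    have "prob {\<omega> \<in> space M. X \<omega> \<in> ?K''} \<le> prob {\<omega> \<in> space M. X \<omega> \<notin> cube d b}"
      by (intro finite_measure_mono) auto
    with b show "prob {\<omega> \<in> space M. X \<omega> \<in> ?K''} \<le> q" by simp
  qed (use pos in \<open>auto simp: emeasure_cube emeasure_cube_diff_le\<close>)
  also have "\<dots> = ennreal (a powr s + p powr r * b powr s + q powr r * c powr s)"
    by (simp add: ennreal_plus[symmetric] del: ennreal_plus)
  finally show ?thesis .
qed

text \<open>
  Call a summand an outlier when it leaves the unit cube. Without outliers the sum of \<open>n\<close> vectors
  stays in the cube of side \<open>n\<close>. With one outlier it almost surely still stays in the cube of
  side \<open>L + n\<close>, which for large \<open>L\<close> is hardly bigger than the support of a single summand. By
  independence two outliers have probability of order \<open>p\<^sup>2\<close> only, so little mass is spread over the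
  much bigger cube of side \<open>n L\<close>.
\<close>

context
  fixes X :: "'i \<Rightarrow> 'a \<Rightarrow> nat \<Rightarrow> real" and d I p L
  assumes indep: "indep_vars (\<lambda>_. lborel_vec d) X I" and I: "finite I" and L: "0 \<le> L"
    and outlier: "\<And>i. i \<in> I \<Longrightarrow> prob {\<omega> \<in> space M. X i \<omega> \<notin> cube d 1} \<le> p"
    and supp: "\<And>i. i \<in> I \<Longrightarrow> AE \<omega> in M. X i \<omega> \<in> cube d L"
begin

lemma X_measurable: "i \<in> I \<Longrightarrow> X i \<in> measurable M (lborel_vec d)"
  using indep by (auto simp: indep_vars_def)

lemma outlier_sets [measurable]: "i \<in> I \<Longrightarrow> {\<omega> \<in> space M. X i \<omega> \<notin> cube d 1} \<in> sets M"
  using X_measurable[of i] by measurable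

lemma prob_one_outlier:
  "prob {\<omega> \<in> space M. vec_sum d X I \<omega> \<notin> cube d (real (card I))} \<le> real (card I) * p"
proof -
  let ?E = "\<lambda>i. {\<omega> \<in> space M. X i \<omega> \<notin> cube d 1}"
  have "{\<omega> \<in> space M. vec_sum d X I \<omega> \<notin> cube d (real (card I))} \<subseteq> (\<Union>i\<in>I. ?E i)"
    using sum_mem_cube[of I X _ d "\<lambda>_. 1"] by auto
  then have "prob {\<omega> \<in> space M. vec_sum d X I \<omega> \<notin> cube d (real (card I))} \<le> prob (\<Union>i\<in>I. ?E i)"
    using I by (intro finite_measure_mono) auto
  also have "\<dots> \<le> (\<Sum>i\<in>I. prob (?E i))"
    using I by (intro finite_measure_subadditive_finite) auto
  also have "\<dots> \<le> real (card I) * p"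
    using sum_mono[of I "\<lambda>i. prob (?E i)" "\<lambda>_. p"] outlier by simp
  finally show ?thesis .
qed

lemma prob_two_outliers:
  "prob {\<omega> \<in> space M. vec_sum d X I \<omega> \<notin> cube d (L + real (card I))} \<le> (real (card I) * p)\<^sup>2"
proof -
  let ?E = "\<lambda>i. {\<omega> \<in> space M. X i \<omega> \<notin> cube d 1}"
  let ?P = "{(i, j) \<in> I \<times> I. i \<noteq> j}"
  have P: "finite ?P"
    using I by (auto intro: finite_subset[of _ "I \<times> I"])
  have two: "\<exists>i\<in>I. \<exists>j\<in>I. i \<noteq> j \<and> X i \<omega> \<notin> cube d 1 \<and> X j \<omega> \<notin> cube d 1"
    if out: "vec_sum d X I \<omega> \<notin> cube d (L + real (card I))" and L': "\<forall>i\<in>I. X i \<omega> \<in> cube d L" for \<omega>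
  proof (rule ccontr)
    assume no: "\<not> ?thesis"
    define a where "a i = (if X i \<omega> \<in> cube d 1 then 1 else L)" for i
    have "vec_sum d X I \<omega> \<in> cube d (sum a I)"
      using L' by (intro sum_mem_cube) (auto simp: a_def)
    moreover have "sum a I \<le> L + real (card I)"
    proof (cases "\<exists>j\<in>I. X j \<omega> \<notin> cube d 1")
      case True
      then obtain j where j: "j \<in> I" "X j \<omega> \<notin> cube d 1" by blast
      then have "sum a (I - {j}) = (\<Sum>i\<in>I - {j}. 1)"
        using no by (intro sum.cong) (auto simp: a_def)
      then have "sum a I = L + real (card (I - {j}))"
        using j I by (simp add: sum.remove[of I j] a_def)
      then show ?thesis
        using card_mono[of I "I - {j}"] I by auto
    next
      case False
      then have "sum a I = (\<Sum>i\<in>I. 1)"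
        by (intro sum.cong) (auto simp: a_def)
      then show ?thesis using L by simp
    qed
    ultimately show False
      using out cube_mono[of "sum a I" "L + real (card I)" d] by auto
  qed
  have "AE \<omega> in M. \<forall>i\<in>I. X i \<omega> \<in> cube d L"
    using I supp by (intro AE_finite_allI) auto
  then have "AE \<omega> in M. \<omega> \<in> {\<omega> \<in> space M. vec_sum d X I \<omega> \<notin> cube d (L + real (card I))} \<longrightarrow>
      \<omega> \<in> (\<Union>(i, j)\<in>?P. ?E i \<inter> ?E j)"
  proof eventually_elim
    case (elim \<omega>)
    then show ?case using two[of \<omega>] by auto
  qed
  then have "prob {\<omega> \<in> space M. vec_sum d X I \<omega> \<notin> cube d (L + real (card I))}
      \<le> prob (\<Union>(i, j)\<in>?P. ?E i \<inter> ?E j)"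
    using P by (intro finite_measure_mono_AE sets.finite_UN) (auto intro!: sets.Int outlier_sets)
  also have "\<dots> \<le> (\<Sum>(i, j)\<in>?P. prob (?E i \<inter> ?E j))"
    using finite_measure_subadditive_finite[OF P, of "\<lambda>(i, j). ?E i \<inter> ?E j"]
    by (auto simp: case_prod_beta image_subset_iff intro!: sets.Int outlier_sets)
  also have "\<dots> \<le> (\<Sum>(i, j)\<in>?P. p\<^sup>2)"
  proof (rule sum_mono, clarify)
    fix i j assume ij: "i \<in> I" "j \<in> I" "i \<noteq> j"
    have vimage: "X k -` (space (lborel_vec d) - cube d 1) \<inter> space M = ?E k" if "k \<in> I" for k
      using X_measurable[OF that] by (auto dest: measurable_space)
    have "prob (\<Inter>k\<in>{i, j}. X k -` (space (lborel_vec d) - cube d 1) \<inter> space M)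
        = (\<Prod>k\<in>{i, j}. prob (X k -` (space (lborel_vec d) - cube d 1) \<inter> space M))"
      using ij by (intro indep_varsD[OF indep]) auto
    then have "prob (?E i \<inter> ?E j) = prob (?E i) * prob (?E j)"
      using ij by (simp add: vimage)
    also have "\<dots> \<le> p\<^sup>2"
      unfolding power2_eq_square using ij outlier order_trans[OF measure_nonneg outlier]
      by (intro mult_mono) auto
    finally show "prob (?E i \<inter> ?E j) \<le> p\<^sup>2" .
  qed
  also have "\<dots> = real (card ?P) * p\<^sup>2"
    by simp
  also have "\<dots> \<le> (real (card I))\<^sup>2 * p\<^sup>2"
  proof (intro mult_right_mono)
    have "card ?P \<le> card (I \<times> I)"
      using I by (intro card_mono) auto
    then show "real (card ?P) \<le> (real (card I))\<^sup>2"
      by (simp add: card_cartesian_product power2_eq_square flip: of_nat_mult)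
  qed simp
  finally show ?thesis
    by (simp add: power_mult_distrib)
qed

lemma AE_vec_sum_mem_cube: "AE \<omega> in M. vec_sum d X I \<omega> \<in> cube d (real (card I) * L)"
proof -
  have "AE \<omega> in M. \<forall>i\<in>I. X i \<omega> \<in> cube d L"
    using I supp by (intro AE_finite_allI) auto
  then show ?thesis
  proof eventually_elim
    case (elim \<omega>)
    then show ?case
      using sum_mem_cube[of I X \<omega> d "\<lambda>_. L"] by simp
  qed
qed

end

end

section \<open>The two-scale density\<close>

text \<open>
  The law that is uniform on the unit cube with probability \<open>1 - p\<close>, and otherwise uniform on the cube
  of side \<open>L\<close>.
\<close>

definition two_scale_density :: "nat \<Rightarrow> real \<Rightarrow> real \<Rightarrow> (nat \<Rightarrow> real) \<Rightarrow> ennreal" where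
  "two_scale_density d p L x =
     ennreal (1 - p) * indicator (cube d 1) x + ennreal (p / L ^ d) * indicator (cube d L) x"

context
  fixes d :: nat and p L :: real
  assumes p: "0 < p" "p \<le> 1" and L: "1 \<le> L"
begin

lemma measurable_two_scale_density [measurable]:
  "two_scale_density d p L \<in> borel_measurable (lborel_vec d)"
  unfolding two_scale_density_def by measurable

lemma emeasure_two_scale:
  assumes A: "A \<in> sets (lborel_vec d)"
  shows "emeasure (density (lborel_vec d) (two_scale_density d p L)) A =
    ennreal (1 - p) * emeasure (lborel_vec d) (cube d 1 \<inter> A) +
    ennreal (p / L ^ d) * emeasure (lborel_vec d) (cube d L \<inter> A)"
proof -
  have [measurable]: "A \<in> sets (lborel_vec d)" by fact
  have "emeasure (density (lborel_vec d) (two_scale_density d p L)) A =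
    (\<integral>\<^sup>+x. ennreal (1 - p) * indicator (cube d 1 \<inter> A) x + ennreal (p / L ^ d) * indicator (cube d L \<inter> A) x
      \<partial>lborel_vec d)"
    by (subst emeasure_density)
      (auto simp: two_scale_density_def intro!: nn_integral_cong split: split_indicator)
  also have "\<dots> = ennreal (1 - p) * emeasure (lborel_vec d) (cube d 1 \<inter> A) +
    ennreal (p / L ^ d) * emeasure (lborel_vec d) (cube d L \<inter> A)"
    by (simp add: nn_integral_add nn_integral_cmult)
  finally show ?thesis .
qed

lemma emeasure_large_cube_scaled: "ennreal (p / L ^ d) * emeasure (lborel_vec d) (cube d L) = ennreal p"
  using p L by (simp add: emeasure_cube ennreal_mult'[symmetric])

lemma prob_space_two_scale: "prob_space (density (lborel_vec d) (two_scale_density d p L))"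
proof
  have "cube d a \<inter> space (lborel_vec d) = cube d a" for a
    using sets.sets_into_space[OF sets_cube] by blast
  then show "emeasure (density (lborel_vec d) (two_scale_density d p L))
      (space (density (lborel_vec d) (two_scale_density d p L))) = 1"
    using p by (simp add: emeasure_two_scale emeasure_large_cube_scaled emeasure_cube
        ennreal_plus[symmetric] del: ennreal_plus)
qed

lemma two_scale_outlier:
  "emeasure (density (lborel_vec d) (two_scale_density d p L)) (space (lborel_vec d) - cube d 1) \<le> ennreal p"
proof -
  have "cube d 1 \<inter> (space (lborel_vec d) - cube d 1) = {}"
    by auto
  then have "emeasure (density (lborel_vec d) (two_scale_density d p L)) (space (lborel_vec d) - cube d 1)
      = ennreal (p / L ^ d) * emeasure (lborel_vec d) (cube d L \<inter> (space (lborel_vec d) - cube d 1))"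
    by (subst emeasure_two_scale) auto
  also have "\<dots> \<le> ennreal (p / L ^ d) * emeasure (lborel_vec d) (cube d L)"
    by (intro mult_left_mono emeasure_mono) auto
  finally show ?thesis
    by (simp add: emeasure_large_cube_scaled)
qed

lemma two_scale_supp: "AE x in density (lborel_vec d) (two_scale_density d p L). x \<in> cube d L"
proof -
  have "x \<in> cube d L" if "0 < two_scale_density d p L x" for x
    using that cube_mono[OF L, of d] by (auto simp: two_scale_density_def split: split_indicator_asm)
  then show ?thesis
    by (subst AE_density) auto
qed

text \<open>
  On the large cube the density is at least \<open>p / L\<^sup>d\<close>, and that constant alone gives this much.
\<close>

lemma two_scale_entropy_integral_ge:
  assumes r: "0 < r"
  shows "ennreal (p powr r * L powr (real d * (1 - r)))
    \<le> (\<integral>\<^sup>+x. ennreal (enn2real (two_scale_density d p L x) powr r) \<partial>lborel_vec d)"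
proof -
  have "p powr r * L powr (real d * (1 - r)) = (p / L ^ d) powr r * L ^ d"
    using p L by (simp add: powr_divide powr_powr powr_diff right_diff_distrib flip: powr_realpow)
  then have "ennreal (p powr r * L powr (real d * (1 - r))) =
      (\<integral>\<^sup>+x. ennreal ((p / L ^ d) powr r) * indicator (cube d L) x \<partial>lborel_vec d)"
    using L by (simp add: nn_integral_cmult emeasure_cube ennreal_mult')
  also have "\<dots> \<le> (\<integral>\<^sup>+x. ennreal (enn2real (two_scale_density d p L x) powr r) \<partial>lborel_vec d)"
  proof (rule nn_integral_mono)
    fix x
    have "p / L ^ d \<le> enn2real (two_scale_density d p L x)" if "x \<in> cube d L"
    proof -
      have "ennreal (p / L ^ d) \<le> two_scale_density d p L x"
        using that by (simp add: two_scale_density_def)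
      moreover have "two_scale_density d p L x < top"
        by (auto simp: two_scale_density_def ennreal_mult_less_top split: split_indicator)
      ultimately have "enn2real (ennreal (p / L ^ d)) \<le> enn2real (two_scale_density d p L x)"
        by (rule enn2real_mono)
      then show ?thesis
        using p L by simp
    qed
    then show "ennreal ((p / L ^ d) powr r) * indicator (cube d L) x
        \<le> ennreal (enn2real (two_scale_density d p L x) powr r)"
      using p L r by (auto intro!: ennreal_leI powr_mono2 split: split_indicator)
  qed
  finally show ?thesis .
qed

end

section \<open>From entropy integrals to entropy powers\<close>

lemma ext_ln_mono: "x \<le> y \<Longrightarrow> ext_ln x \<le> ext_ln y"
  by (cases x; cases y) (auto simp: ext_ln_def ennreal_eq_0_iff top_unique)

lemma ext_exp_mono: "x \<le> y \<Longrightarrow> ext_exp x \<le> ext_exp y"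
  by (cases x; cases y) (auto simp: ext_exp_def ennreal_leI)

lemma renyi_entropy_power_distributed:
  assumes "distributed M (lborel_vec d) X f"
  shows "renyi_entropy_power M d r X = ext_exp (ereal (2 / real d) * (ereal (1 / (1 - r)) *
    ext_ln (\<integral>\<^sup>+ x. ennreal (enn2real (f x) powr r) \<partial>lborel_vec d)))"
  unfolding renyi_entropy_power_def renyi_entropy_distributed[OF assms] ..

lemma ext_exp_ext_ln_ennreal:
  "0 < a \<Longrightarrow> ext_exp (ereal b * (ereal c * ext_ln (ennreal a))) = ennreal (a powr (b * c))"
  by (simp add: ext_exp_def ext_ln_def powr_def mult_ac)

text \<open>
  The entropy power is the power of exponent \<open>2 / (d (1 - r))\<close> of the entropy integral. As
  \<open>r < 1\<close>, this is increasing, so bounds on one carry over to the other in the same direction.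
\<close>

lemma renyi_entropy_power_le:
  assumes X: "distributed M (lborel_vec d) X f" and r: "r < 1" and a: "0 < a"
    and le: "(\<integral>\<^sup>+ x. ennreal (enn2real (f x) powr r) \<partial>lborel_vec d) \<le> ennreal a"
  shows "renyi_entropy_power M d r X \<le> ennreal (a powr (2 / (real d * (1 - r))))"
proof -
  have "renyi_entropy_power M d r X
      \<le> ext_exp (ereal (2 / real d) * (ereal (1 / (1 - r)) * ext_ln (ennreal a)))"
    unfolding renyi_entropy_power_distributed[OF X]
    using r le by (intro ext_exp_mono ereal_mult_left_mono ext_ln_mono) auto
  then show ?thesis
    using a by (simp only: ext_exp_ext_ln_ennreal) simp
qed

lemma renyi_entropy_power_ge:
  assumes X: "distributed M (lborel_vec d) X f" and r: "r < 1" and a: "0 < a"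
    and ge: "ennreal a \<le> (\<integral>\<^sup>+ x. ennreal (enn2real (f x) powr r) \<partial>lborel_vec d)"
  shows "ennreal (a powr (2 / (real d * (1 - r)))) \<le> renyi_entropy_power M d r X"
proof -
  have "ext_exp (ereal (2 / real d) * (ereal (1 / (1 - r)) * ext_ln (ennreal a)))
      \<le> renyi_entropy_power M d r X"
    unfolding renyi_entropy_power_distributed[OF X]
    using r ge by (intro ext_exp_mono ereal_mult_left_mono ext_ln_mono) auto
  then show ?thesis
    using a by (simp only: ext_exp_ext_ln_ennreal) simp
qed

section \<open>Choice of the parameters and the counterexample\<close>

text \<open>
  Here \<open>s = d (1 - r)\<close>, and \<open>p\<^sup>r L\<^sup>s\<close> is the lower bound for one summand. The left-hand side is the
  upper bound for the sum, with its contributions of no, one, and several outliers. The middle one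
  is about \<open>n\<^sup>r p\<^sup>r L\<^sup>s\<close>. It dominates if \<open>p\<^sup>r L\<^sup>s\<close> tends to infinity while \<open>p\<^bsup>2 r\<^esup> L\<^sup>s\<close> tends to zero;
  \<open>p = L\<^bsup>- 2 s / (3 r)\<^esup>\<close> makes them \<open>L\<^bsup>s / 3\<^esup>\<close> and \<open>L\<^bsup>- s / 3\<^esup>\<close>. The constant \<open>2\<close> only leaves room for the
  limit \<open>L \<rightarrow> \<infinity>\<close>.
\<close>

lemma two_scale_parameters:
  fixes r s :: real and n :: nat
  assumes r: "0 < r" and s: "0 < s" and n: "1 \<le> n"
  obtains p L where "0 < p" "p \<le> 1" "1 \<le> L"
    "real n powr s + (real n * p) powr r * (L + real n) powr s + ((real n * p)\<^sup>2) powr r * (real n * L) powr s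
      < 2 * real n powr r * (p powr r * L powr s)"
proof -
  define N where "N = real n"
  have N: "1 \<le> N" using n by (simp add: N_def)
  \<comment> \<open>The three contributions after division by \<open>p\<^sup>r L\<^sup>s = L\<^bsup>s / 3\<^esup>\<close>.\<close>
  have "((\<lambda>L. N powr s * L powr (- (s / 3)) + N powr r * (1 + N / L) powr s
      + N powr (2 * r + s) * L powr (- (2 * s / 3)))
      \<longlongrightarrow> N powr s * 0 + N powr r * (1 + 0) powr s + N powr (2 * r + s) * 0) at_top"
    using s by (intro tendsto_intros tendsto_neg_powr filterlim_ident tendsto_divide_0[OF tendsto_const]
        filterlim_at_top_imp_at_infinity) auto
  moreover have "N powr s * 0 + N powr r * (1 + 0) powr s + N powr (2 * r + s) * 0 < 2 * N powr r"
    using N by simp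
  ultimately have "eventually (\<lambda>L. N powr s * L powr (- (s / 3)) + N powr r * (1 + N / L) powr s
      + N powr (2 * r + s) * L powr (- (2 * s / 3)) < 2 * N powr r) at_top"
    by (rule order_tendstoD)
  with eventually_ge_at_top[of 1] have "eventually (\<lambda>L. 1 \<le> L \<and> N powr s * L powr (- (s / 3))
      + N powr r * (1 + N / L) powr s + N powr (2 * r + s) * L powr (- (2 * s / 3)) < 2 * N powr r) at_top"
    by eventually_elim auto
  then obtain L where L: "1 \<le> L" and less: "N powr s * L powr (- (s / 3))
      + N powr r * (1 + N / L) powr s + N powr (2 * r + s) * L powr (- (2 * s / 3)) < 2 * N powr r"
    using eventually_happens[of _ "at_top :: real filter"] by auto
  define p where "p = L powr (- (2 * s / (3 * r)))"
  have p: "0 < p" "p \<le> 1"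
    using L r s powr_mono[of "- (2 * s / (3 * r))" 0 L] by (auto simp: p_def)
  have pr: "p powr r = L powr (- (2 * s / 3))"
    using r by (simp add: p_def powr_powr)
  have A: "p powr r * L powr s = L powr (s / 3)"
    using L by (simp add: pr flip: powr_add)
  have "N powr s = N powr s * L powr (- (s / 3)) * L powr (s / 3)"
    using L by (simp add: mult.assoc flip: powr_add)
  moreover have "(N * p) powr r * (L + N) powr s = N powr r * (1 + N / L) powr s * L powr (s / 3)"
  proof -
    have "L + N = L * (1 + N / L)" using L by (simp add: field_simps)
    then have "(L + N) powr s = L powr s * (1 + N / L) powr s"
      using L N by (simp add: powr_mult)
    then show ?thesis
      using N p A[symmetric] by (simp add: powr_mult)
  qed
  moreover have "((N * p)\<^sup>2) powr r * (N * L) powr s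
      = N powr (2 * r + s) * L powr (- (2 * s / 3)) * L powr (s / 3)"
  proof -
    have "((N * p)\<^sup>2) powr r = N powr (2 * r) * (p powr r) * (p powr r)"
      using N p powr_add[of N r r] by (simp add: power2_eq_square powr_mult mult_ac)
    then have "((N * p)\<^sup>2) powr r * (N * L) powr s
        = N powr (2 * r + s) * p powr r * (p powr r * L powr s)"
      using N L by (simp add: powr_mult powr_add)
    then show ?thesis
      unfolding A by (simp add: pr)
  qed
  ultimately have "N powr s + (N * p) powr r * (L + N) powr s + ((N * p)\<^sup>2) powr r * (N * L) powr s
      = (N powr s * L powr (- (s / 3)) + N powr r * (1 + N / L) powr s
        + N powr (2 * r + s) * L powr (- (2 * s / 3))) * L powr (s / 3)"
    by (simp add: distrib_right)
  also have "\<dots> < 2 * N powr r * L powr (s / 3)"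
    using less L by (intro mult_strict_right_mono) auto
  finally show ?thesis
    using that[OF p L] by (simp add: A N_def)
qed

theorem theorem1:
  fixes r \<epsilon> :: real
  assumes "0 < r" and "r < 1" and "0 < \<epsilon>"
  shows "\<exists>(d::nat) (n::nat) (M :: (nat \<Rightarrow> nat \<Rightarrow> real) measure)
           (X :: nat \<Rightarrow> (nat \<Rightarrow> nat \<Rightarrow> real) \<Rightarrow> nat \<Rightarrow> real).
           1 \<le> d \<and> 2 \<le> n \<and> prob_space M \<and>
           prob_space.indep_vars M (\<lambda>_. lborel_vec d) X {1..n} \<and>
           (\<forall>i\<in>{1..n}. has_density M d (X i)) \<and>
           has_density M d (vec_sum d X {1..n}) \<and>
           renyi_entropy_power M d r (vec_sum d X {1..n})
             < ennreal \<epsilon> * (\<Sum>i=1..n. renyi_entropy_power M d r (X i))"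
proof -
  note r = assms(1,2) and \<epsilon> = assms(3)
  \<comment> \<open>In this dimension the exponent \<open>2 / (d (1 - r))\<close> of the entropy power is at most \<open>1 / 2\<close>.\<close>
  obtain d :: nat where d: "4 / (1 - r) \<le> real d"
    using real_arch_simple by blast
  define s where "s = real d * (1 - r)"
  have s: "4 \<le> s"
    using d r by (simp add: s_def field_simps)
  then have d1: "1 \<le> d"
    by (cases d) (auto simp: s_def)
  \<comment> \<open>Then \<open>sqrt (2 n) \<le> \<epsilon> n\<close>, which beats the growth factor of the entropy power of the sum.\<close>
  obtain n0 :: nat where n0: "2 / \<epsilon>\<^sup>2 \<le> real n0"
    using real_arch_simple by blast
  define n where "n = max 2 n0"
  have n: "2 \<le> n" and "2 / \<epsilon>\<^sup>2 \<le> real n"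
    using n0 by (auto simp: n_def)
  then have n\<epsilon>: "2 * real n \<le> (\<epsilon> * real n)\<^sup>2"
    using \<epsilon> by (simp add: field_simps power2_eq_square)
  obtain p L where p: "0 < p" "p \<le> 1" and L: "1 \<le> L" and
    less: "real n powr s + (real n * p) powr r * (L + real n) powr s
        + ((real n * p)\<^sup>2) powr r * (real n * L) powr s < 2 * real n powr r * (p powr r * L powr s)"
      (is "?B < _ * ?A")
    using two_scale_parameters[of r s n] r s n by auto

  let ?L = "lborel_vec d" and ?f = "two_scale_density d p L"
  define \<mu> where "\<mu> = density ?L ?f"
  define M where "M = PiM {1..n} (\<lambda>_. \<mu>)"
  define X :: "nat \<Rightarrow> (nat \<Rightarrow> nat \<Rightarrow> real) \<Rightarrow> nat \<Rightarrow> real" where "X = (\<lambda>i \<omega>. \<omega> i)"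
  have \<mu>: "prob_space \<mu>"
    unfolding \<mu>_def by (rule prob_space_two_scale[OF p L])
  interpret M: prob_space M
    unfolding M_def using \<mu> by (intro prob_space_PiM)
  have sets_\<mu>: "sets \<mu> = sets ?L" and space_\<mu>: "space \<mu> = space ?L"
    by (simp_all add: \<mu>_def)
  have indep: "M.indep_vars (\<lambda>_. ?L) X {1..n}"
  proof -
    have "M.indep_vars (\<lambda>_. \<mu>) X {1..n}"
      unfolding M_def X_def using \<mu> n by (intro indep_vars_PiM_coordinates) auto
    then show ?thesis
      by (simp add: M.indep_vars_def measurable_cong_sets[OF refl sets_\<mu>] sets_\<mu>)
  qed
  have X [measurable]: "X i \<in> measurable M ?L" if "i \<in> {1..n}" for i
    using indep that by (simp add: M.indep_vars_def)
  have law: "distr M ?L (X i) = \<mu>" if "i \<in> {1..n}" for i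
  proof -
    have "distr M ?L (X i) = distr M \<mu> (X i)"
      by (intro distr_cong) (simp_all add: sets_\<mu>)
    also have "\<dots> = \<mu>"
      unfolding M_def X_def using \<mu> that by (intro distr_PiM_component) auto
    finally show ?thesis .
  qed
  have X_dist: "distributed M ?L (X i) ?f" if "i \<in> {1..n}" for i
    using X[OF that] law[OF that] measurable_two_scale_density[OF p L]
    by (simp add: distributed_def \<mu>_def)
  then have X_dens: "\<forall>i\<in>{1..n}. has_density M d (X i)"
    unfolding has_density_def by blast
  have S_dens: "has_density M d (vec_sum d X {1..n})"
    using X_dens n by (intro M.has_density_vec_sum[OF indep, of 1]) auto
  then obtain g where g: "distributed M ?L (vec_sum d X {1..n}) g"
    by (auto simp: has_density_def)

  have outlier: "M.prob {\<omega> \<in> space M. X i \<omega> \<notin> cube d 1} \<le> p" if i: "i \<in> {1..n}" for i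
  proof -
    have "{\<omega> \<in> space M. X i \<omega> \<notin> cube d 1} = X i -` (space ?L - cube d 1) \<inter> space M"
      using measurable_space[OF X[OF i]] by auto
    then have "ennreal (M.prob {\<omega> \<in> space M. X i \<omega> \<notin> cube d 1}) = emeasure \<mu> (space ?L - cube d 1)"
      using X[OF i] by (simp add: M.emeasure_eq_measure[symmetric] emeasure_distr flip: law[OF i])
    also have "\<dots> \<le> ennreal p"
      unfolding \<mu>_def by (rule two_scale_outlier[OF p L])
    finally show ?thesis
      using p by simp
  qed
  have supp: "AE \<omega> in M. X i \<omega> \<in> cube d L" if i: "i \<in> {1..n}" for i
    using two_scale_supp[OF p L, of d] X[OF i] unfolding \<mu>_def[symmetric] law[OF i, symmetric]
    by (subst (asm) AE_distr_iff) auto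

  have "renyi_entropy_power M d r (vec_sum d X {1..n}) \<le> ennreal (?B powr (2 / s))"
    unfolding s_def
  proof (rule renyi_entropy_power_le[OF g r(2)])
    show "(\<integral>\<^sup>+ x. ennreal (enn2real (g x) powr r) \<partial>?L) \<le> ennreal (real n powr (real d * (1 - r))
        + (real n * p) powr r * (L + real n) powr (real d * (1 - r))
        + ((real n * p)\<^sup>2) powr r * (real n * L) powr (real d * (1 - r)))"
      using M.prob_one_outlier[OF indep _ _ outlier supp]
        M.prob_two_outliers[OF indep _ _ outlier supp]
        M.AE_vec_sum_mem_cube[OF indep _ _ outlier supp] p L n
      by (intro M.entropy_integral_le_cubes[OF g r]) auto
  qed (use n in \<open>auto intro!: add_pos_nonneg\<close>)
  also have "\<dots> < ennreal (\<epsilon> * (real n * ?A powr (2 / s)))"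
  proof (rule ennreal_lessI)
    have "?B powr (2 / s) < (2 * real n powr r * ?A) powr (2 / s)"
      using less s by (intro powr_less_mono2) auto
    also have "\<dots> = (2 * real n powr r) powr (2 / s) * ?A powr (2 / s)"
      by (rule powr_mult)
    also have "\<dots> \<le> (\<epsilon> * real n) * ?A powr (2 / s)"
    proof (intro mult_right_mono)
      have "real n powr r \<le> real n powr 1"
        using r n by (intro powr_mono) auto
      then have "(2 * real n powr r) powr (2 / s) \<le> (2 * real n) powr (2 / s)"
        using s n by (intro powr_mono2) auto
      also have "\<dots> \<le> (2 * real n) powr (1 / 2)"
        using s n by (intro powr_mono) (auto simp: field_simps)
      also have "\<dots> = sqrt (2 * real n)"
        by (simp add: powr_half_sqrt)
      also have "\<dots> \<le> \<epsilon> * real n"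
        using n\<epsilon> \<epsilon> by (intro real_le_lsqrt) auto
      finally show "(2 * real n powr r) powr (2 / s) \<le> \<epsilon> * real n" .
    qed simp
    finally show "?B powr (2 / s) < \<epsilon> * (real n * ?A powr (2 / s))"
      by (simp add: mult.assoc)
    show "0 < \<epsilon> * (real n * ?A powr (2 / s))"
      using \<epsilon> n p L by (intro mult_pos_pos) simp_all
  qed
  also have "\<dots> = ennreal \<epsilon> * (\<Sum>i=1..n. ennreal (?A powr (2 / s)))"
    using \<epsilon> by (simp add: ennreal_mult' ennreal_of_nat_eq_real_of_nat)
  also have "\<dots> \<le> ennreal \<epsilon> * (\<Sum>i=1..n. renyi_entropy_power M d r (X i))"
  proof (intro mult_left_mono sum_mono)
    fix i assume "i \<in> {1..n}"
    then show "ennreal (?A powr (2 / s)) \<le> renyi_entropy_power M d r (X i)"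
      unfolding s_def using p L r two_scale_entropy_integral_ge[OF p L r(1), of d]
      by (intro renyi_entropy_power_ge[OF X_dist]) auto
  qed simp
  finally show ?thesis
    using d1 n M.prob_space_axioms indep X_dens S_dens by blast
qed

end
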